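(* Let $B$ be a finite skew brace and let $I$ be an ideal of $B$ such that $I\subseteq\mathrm{Fix}(B)$. Then $\mathrm{C}_B(I)$ is an ideal of $B$, and $\mathrm{C}_B(I)=\widetilde{\mathrm{C}}_B(I)$.
   Context: A skew (left) brace is a set $B$ with two group operations $(B,+)$ and $(B,\cdot)$ (neither assumed commutative) such that $a(b+c)=ab-a+ac$ for all $a,b,c\in B$; the two groups share the same identity $0$. The lambda map is $\lambda\colon (B,\cdot)\to\mathrm{Aut}(B,+)$, $\lambda_a(b)=-a+ab$. $\mathrm{Fix}(B)=\{b\in B\mid \lambda_a(b)=b\text{ for all }a\in B\}$. A subbrace of $B$ is a subset that is a subgroup of both $(B,+)$ and $(B,\cdot)$. An ideal of $B$ is a subbrace $I$ with $\lambda_b(I)\subseteq I$ for all $b\in B$ that is normal in both $(B,+)$ and $(B,\cdot)$. For a subbrace $A\subseteq\mathrm{Fix}(B)$, the centraliser of $A$ is $\mathrm{C}_B(A)=\mathrm{C}_{(B,+)}(A,+)\cap\mathrm{C}_{(B,\cdot)}(A,\cdot)$; it is known to be a subbrace of $B$. For ideals $I,J$ of $B$, the ideal commutator $[I,J]^B$ is the smallest ideal of $B$ containing $[I,J]_+$, $[I,J]_\bullet$ and $\{ij-(i+j)\mid i\in I,\ j\in J\}$, where $[I,J]_+$ and $[I,J]_\bullet$ denote the commutator subgroups of $I$ and $J$ in $(B,+)$ and $(B,\cdot)$ respectively. The ideal centraliser $\widetilde{\mathrm{C}}_B(I)$ of an ideal $I$ is the unique maximal (i.e. largest) ideal $J$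 of $B$ such that $[I,J]^B=0$. *)

theory Defs
  imports "HOL-Algebra.Generated_Groups" "HOL-Algebra.Ring"
begin

text \<open>
  A skew brace is carried by the \<open>ring\<close> record purely as a signature: \<open>B\<close> itself is the group
  \<open>(B, \<cdot>)\<close> and \<open>add_monoid B\<close> is the group \<open>(B, +)\<close>. Neither group is assumed commutative and the
  ring axioms are not assumed. The equality \<open>\<one> = \<zero>\<close> is a consequence of the axioms.
\<close>

locale skew_brace = group B for B (structure) +
  assumes a_group: "group (add_monoid B)"
    and brace_eq: "\<lbrakk>a \<in> carrier B; b \<in> carrier B; c \<in> carrier B\<rbrakk>
      \<Longrightarrow> a \<otimes> (b \<oplus> c) = ((a \<otimes> b) \<ominus> a) \<oplus> (a \<otimes> c)"

definition brace_lambda :: "('a, 'm) ring_scheme \<Rightarrow> 'a \<Rightarrow> 'a \<Rightarrow> 'a" where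
  "brace_lambda B a b = (\<ominus>\<^bsub>B\<^esub> a) \<oplus>\<^bsub>B\<^esub> (a \<otimes>\<^bsub>B\<^esub> b)"

definition brace_Fix :: "('a, 'm) ring_scheme \<Rightarrow> 'a set" where
  "brace_Fix B = {b \<in> carrier B. \<forall>a \<in> carrier B. brace_lambda B a b = b}"

definition subbrace :: "'a set \<Rightarrow> ('a, 'm) ring_scheme \<Rightarrow> bool" where
  "subbrace A B \<longleftrightarrow> subgroup A (add_monoid B) \<and> subgroup A B"

definition brace_ideal :: "'a set \<Rightarrow> ('a, 'm) ring_scheme \<Rightarrow> bool" where
  "brace_ideal I B \<longleftrightarrow> subbrace I B
     \<and> (\<forall>b \<in> carrier B. brace_lambda B b ` I \<subseteq> I)
     \<and> I \<lhd> add_monoid B \<and> I \<lhd> B"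

definition group_centraliser :: "('a, 'm) monoid_scheme \<Rightarrow> 'a set \<Rightarrow> 'a set" where
  "group_centraliser G H = {g \<in> carrier G. \<forall>h \<in> H. g \<otimes>\<^bsub>G\<^esub> h = h \<otimes>\<^bsub>G\<^esub> g}"

text \<open>
  The centraliser \<open>C\<^sub>B(A)\<close>; intended for subbraces \<open>A\<close> of \<open>B\<close> contained in \<open>brace_Fix B\<close>,
  where it is again a subbrace.
\<close>

definition brace_centraliser :: "('a, 'm) ring_scheme \<Rightarrow> 'a set \<Rightarrow> 'a set" where
  "brace_centraliser B A = group_centraliser (add_monoid B) A \<inter> group_centraliser B A"

definition commutator_subgroup :: "('a, 'm) monoid_scheme \<Rightarrow> 'a set \<Rightarrow> 'a set \<Rightarrow> 'a set" where
  "commutator_subgroup G H K =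
     generate G {h \<otimes>\<^bsub>G\<^esub> k \<otimes>\<^bsub>G\<^esub> inv\<^bsub>G\<^esub> h \<otimes>\<^bsub>G\<^esub> inv\<^bsub>G\<^esub> k | h k. h \<in> H \<and> k \<in> K}"

text \<open>
  The smallest ideal containing the three sets below, as an intersection of ideals; the family is
  nonempty because \<open>carrier B\<close> belongs to it.
\<close>

definition ideal_commutator :: "('a, 'm) ring_scheme \<Rightarrow> 'a set \<Rightarrow> 'a set \<Rightarrow> 'a set" where
  "ideal_commutator B I J = \<Inter> {K. brace_ideal K B
     \<and> commutator_subgroup (add_monoid B) I J \<subseteq> K
     \<and> commutator_subgroup B I J \<subseteq> K
     \<and> {(i \<otimes>\<^bsub>B\<^esub> j) \<ominus>\<^bsub>B\<^esub> (i \<oplus>\<^bsub>B\<^esub> j) | i j. i \<in> I \<and> j \<in> J} \<subseteq> K}"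

definition ideal_centraliser :: "('a, 'm) ring_scheme \<Rightarrow> 'a set \<Rightarrow> 'a set" where
  "ideal_centraliser B I = (THE J. brace_ideal J B \<and> ideal_commutator B I J = {\<zero>\<^bsub>B\<^esub>}
     \<and> (\<forall>K. brace_ideal K B \<and> ideal_commutator B I K = {\<zero>\<^bsub>B\<^esub>} \<longrightarrow> K \<subseteq> J))"

end

theory Submission
  imports Defs
begin

text \<open>
  Write \<open>C\<close> for the centraliser of an ideal \<open>I\<close> on whose elements every \<open>\<lambda>\<^sub>a\<close> acts trivially. For
  \<open>x \<in> B\<close> and \<open>i \<in> I\<close> one has \<open>x i = x + i\<close> and \<open>i x = i + \<lambda>\<^sub>i x\<close>, so \<open>x \<in> C\<close> means exactly that \<open>x\<close>
  commutes additively with \<open>I\<close> and is fixed by \<open>\<lambda>\<^sub>i\<close> for all \<open>i \<in> I\<close>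
  (\<open>brace_centraliser_iff\<close>). Both conditions are preserved by the operations in question, for the
  following reasons.

  \<^item> The set \<open>C\<close> is \<open>\<lambda>\<close>-invariant. Each \<open>\<lambda>\<^sub>b\<close> is an additive automorphism fixing \<open>I\<close> pointwise, hence
    preserves the additive centraliser of \<open>I\<close>; and \<open>I\<close> is normal in \<open>(B, \<cdot>)\<close>, so the
    common fixed points of the \<open>\<lambda>\<^sub>i\<close> with \<open>i \<in> I\<close> form a \<open>\<lambda>\<close>-invariant set. A \<open>\<lambda>\<close>-invariant additive subgroup is automatically a
    multiplicative one.

  \<^item> Additive normality: since \<open>I\<close> is normal in both groups, \<open>\<lambda>\<^sub>i b \<in> b + I\<close> for \<open>i \<in> I\<close>. As \<open>c \<in> C\<close>
    commutes with \<open>I\<close>, applying \<open>\<lambda>\<^sub>i\<close> to the conjugate \<open>b + c - b\<close> does not change it.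

  \<^item> Multiplicative normality: the elements \<open>b\<close> and \<open>\<lambda>\<^sub>x b\<close> induce the same additive conjugation
    on \<open>I\<close>, because \<open>\<lambda>\<^sub>x\<close> fixes \<open>I\<close> pointwise. For \<open>x = b c b\<^sup>-\<^sup>1\<close> the equation \<open>x b = b c\<close> reads
    \<open>x + \<lambda>\<^sub>x b = b + \<lambda>\<^sub>b c\<close>, and \<open>\<lambda>\<^sub>b c\<close> centralises \<open>I\<close>; so \<open>x\<close> commutes additively
    with \<open>I\<close>. It does so multiplicatively because \<open>I\<close> is normal in \<open>(B, \<cdot>)\<close>, and hence so is its
    multiplicative centraliser.

  That \<open>C\<close> is the largest ideal with \<open>[I, C]\<^sup>B = 0\<close> is then formal: for an ideal \<open>J\<close>, the three
  generating sets of \<open>[I, J]\<^sup>B\<close> vanish if and only if \<open>J \<subseteq> C\<close>.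
\<close>

section \<open>Centralisers in groups\<close>

lemma (in group) subgroup_group_centraliser:
  assumes "H \<subseteq> carrier G"
  shows "subgroup (group_centraliser G H) G"
proof (rule subgroupI)
  show "group_centraliser G H \<noteq> {}"
    using assms by (auto simp: group_centraliser_def intro!: exI[of _ \<one>])
next
  fix a assume a: "a \<in> group_centraliser G H"
  have "inv a \<otimes> h = h \<otimes> inv a" if "h \<in> H" for h
  proof -
    have c: "a \<in> carrier G" "h \<in> carrier G" "a \<otimes> h = h \<otimes> a"
      using a assms that by (auto simp: group_centraliser_def)
    have "h = inv a \<otimes> (h \<otimes> a)"
      using c by (metis inv_solve_left m_closed)
    also have "\<dots> = inv a \<otimes> h \<otimes> a"
      using c by (simp add: m_assoc)
    finally show ?thesis
      using c by (metis inv_closed inv_solve_right m_closed)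
  qed
  then show "inv a \<in> group_centraliser G H"
    using a by (simp add: group_centraliser_def)
next
  fix a b assume ab: "a \<in> group_centraliser G H" "b \<in> group_centraliser G H"
  have "a \<otimes> b \<otimes> h = h \<otimes> (a \<otimes> b)" if "h \<in> H" for h
    using ab assms that unfolding group_centraliser_def
    by (smt (verit) m_assoc mem_Collect_eq subsetD)
  then show "a \<otimes> b \<in> group_centraliser G H"
    using ab by (simp add: group_centraliser_def)
qed (simp add: group_centraliser_def)

lemma (in group) normal_group_centraliser:
  assumes "H \<lhd> G"
  shows "group_centraliser G H \<lhd> G"
proof (rule normal_invI)
  interpret H: normal H G by fact
  show "subgroup (group_centraliser G H) G"
    by (rule subgroup_group_centraliser) (rule H.subset)
  fix g c assume g: "g \<in> carrier G" and c: "c \<in> group_centraliser G H"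
  have cG: "c \<in> carrier G"
    using c by (simp add: group_centraliser_def)
  let ?x = "g \<otimes> c \<otimes> inv g"
  have "?x \<otimes> h = h \<otimes> ?x" if h: "h \<in> H" for h
  proof -
    have hG: "h \<in> carrier G"
      using h H.subset by blast
    let ?k = "inv g \<otimes> h \<otimes> g"
    have "?k \<in> H"
      using g h by (rule H.inv_op_closed1)
    then have kc: "c \<otimes> ?k = ?k \<otimes> c"
      using c by (simp add: group_centraliser_def)
    have "?x \<otimes> h = g \<otimes> (c \<otimes> ?k) \<otimes> inv g"
      using g cG hG by (simp add: m_assoc)
    also have "\<dots> = g \<otimes> (?k \<otimes> c) \<otimes> inv g"
      by (simp only: kc)
    also have "\<dots> = (g \<otimes> inv g) \<otimes> h \<otimes> ?x"
      using g cG hG by (simp del: r_inv flip: m_assoc)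
    finally show ?thesis
      using g cG hG by simp
  qed
  then show "?x \<in> group_centraliser G H"
    using g cG by (simp add: group_centraliser_def)
qed

lemma (in group) commutator_eq_one_iff:
  assumes "h \<in> carrier G" "k \<in> carrier G"
  shows "h \<otimes> k \<otimes> inv h \<otimes> inv k = \<one> \<longleftrightarrow> k \<otimes> h = h \<otimes> k"
proof -
  have "h \<otimes> k \<otimes> inv h \<otimes> inv k = (h \<otimes> k) \<otimes> inv (k \<otimes> h)"
    using assms by (simp add: m_assoc inv_mult_group)
  then show ?thesis
    using assms by (metis inv_closed inv_equality inv_inv m_closed r_inv)
qed

lemma (in group) commutator_subgroup_trivial_iff:
  assumes "H \<subseteq> carrier G" "K \<subseteq> carrier G"
  shows "commutator_subgroup G H K \<subseteq> {\<one>} \<longleftrightarrow> K \<subseteq> group_centraliser G H"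
proof
  assume triv: "commutator_subgroup G H K \<subseteq> {\<one>}"
  show "K \<subseteq> group_centraliser G H"
  proof
    fix k assume k: "k \<in> K"
    have "k \<otimes> h = h \<otimes> k" if "h \<in> H" for h
    proof -
      have "h \<otimes> k \<otimes> inv h \<otimes> inv k \<in> commutator_subgroup G H K"
        unfolding commutator_subgroup_def using k that by (blast intro: generate.incl)
      then show ?thesis
        using triv assms k that commutator_eq_one_iff by blast
    qed
    then show "k \<in> group_centraliser G H"
      using k assms by (auto simp: group_centraliser_def)
  qed
next
  assume "K \<subseteq> group_centraliser G H"
  then have "h \<otimes> k \<otimes> inv h \<otimes> inv k = \<one>" if "h \<in> H" "k \<in> K" for h k
    using that assms commutator_eq_one_iff[of h k] by (auto simp: group_centraliser_def)
  then have "{h \<otimes> k \<otimes> inv h \<otimes> inv k |h k. h \<in> H \<and> k \<in> K} \<subseteq> {\<one>}"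
    by blast
  then show "commutator_subgroup G H K \<subseteq> {\<one>}"
    unfolding commutator_subgroup_def by (rule generate_subgroup_incl) (rule triv_subgroup)
qed

section \<open>The lambda action of a skew brace\<close>

context skew_brace
begin

sublocale add: group "add_monoid B"
  rewrites "carrier (add_monoid B) = carrier B"
    and "mult (add_monoid B) = add B"
    and "one (add_monoid B) = zero B"
    and "m_inv (add_monoid B) = a_inv B"
  using a_group by (auto simp: a_inv_def)

lemma one_eq_zero: "\<one> = \<zero>"
proof -
  have "\<zero> = \<ominus> \<one>"
    using brace_eq[of \<one> \<zero> \<zero>] by (simp add: a_minus_def)
  then show ?thesis
    by (metis add.inv_inv add.inv_one one_closed)
qed

lemma lambda_closed [simp]:
  "a \<in> carrier B \<Longrightarrow> b \<in> carrier B \<Longrightarrow> brace_lambda B a b \<in> carrier B"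
  by (simp add: brace_lambda_def)

lemma mult_eq_add_lambda:
  "a \<in> carrier B \<Longrightarrow> b \<in> carrier B \<Longrightarrow> a \<otimes> b = a \<oplus> brace_lambda B a b"
  by (simp add: brace_lambda_def flip: add.m_assoc)

lemma lambda_add:
  "\<lbrakk>a \<in> carrier B; b \<in> carrier B; c \<in> carrier B\<rbrakk>
    \<Longrightarrow> brace_lambda B a (b \<oplus> c) = brace_lambda B a b \<oplus> brace_lambda B a c"
  by (simp add: brace_lambda_def brace_eq a_minus_def add.m_assoc)

lemma lambda_zero [simp]: "a \<in> carrier B \<Longrightarrow> brace_lambda B a \<zero> = \<zero>"
  unfolding brace_lambda_def by (metis add.l_inv one_eq_zero r_one)

lemma lambda_neg:
  assumes "a \<in> carrier B" "b \<in> carrier B"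
  shows "brace_lambda B a (\<ominus> b) = \<ominus> brace_lambda B a b"
proof -
  have "brace_lambda B a (\<ominus> b) \<oplus> brace_lambda B a b = \<zero>"
    using assms by (simp flip: lambda_add)
  then show ?thesis
    using assms by (metis add.inv_closed add.inv_equality lambda_closed)
qed

text \<open>Associativity of \<open>a b c\<close>, with both bracketings expanded by \<open>x y = x + \<lambda>\<^sub>x y\<close>.\<close>

lemma lambda_mult:
  assumes "a \<in> carrier B" "b \<in> carrier B" "c \<in> carrier B"
  shows "brace_lambda B (a \<otimes> b) c = brace_lambda B a (brace_lambda B b c)"
proof -
  have "(a \<otimes> b) \<oplus> brace_lambda B (a \<otimes> b) c = a \<otimes> (b \<otimes> c)"
    using assms by (simp add: m_assoc flip: mult_eq_add_lambda)
  also have "\<dots> = a \<oplus> brace_lambda B a (b \<oplus> brace_lambda B b c)"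
    using assms by (simp flip: mult_eq_add_lambda)
  also have "\<dots> = (a \<otimes> b) \<oplus> brace_lambda B a (brace_lambda B b c)"
    using assms by (simp add: lambda_add mult_eq_add_lambda add.m_assoc)
  finally show ?thesis
    using assms by simp
qed

text \<open>
  The two group structures on a \<open>\<lambda>\<close>-invariant set are tied together by \<open>a b = a + \<lambda>\<^sub>a b\<close> and
  \<open>a\<^sup>-\<^sup>1 = \<lambda>\<^sub>c (- a)\<close> for \<open>c = a\<^sup>-\<^sup>1\<close>.
\<close>

lemma subbrace_if_lambda_invariant:
  assumes sub: "subgroup A (add_monoid B)"
    and inv: "\<And>b a. \<lbrakk>b \<in> carrier B; a \<in> A\<rbrakk> \<Longrightarrow> brace_lambda B b a \<in> A"
  shows "subbrace A B"
proof -
  interpret A: subgroup A "add_monoid B" by fact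
  have AB: "A \<subseteq> carrier B"
    using A.subset by simp
  have "subgroup A B"
  proof (rule subgroupI)
    show "A \<noteq> {}"
      using A.one_closed by blast
  next
    fix a assume a: "a \<in> A"
    then have aB: "a \<in> carrier B"
      using AB by blast
    have "inv a \<oplus> brace_lambda B (inv a) a = \<zero>"
      using aB by (simp add: one_eq_zero flip: mult_eq_add_lambda)
    then have "inv a = \<ominus> brace_lambda B (inv a) a"
      using aB by (metis add.inv_equality inv_closed lambda_closed add.inv_inv)
    also have "\<dots> \<in> A"
      using A.m_inv_closed[of "brace_lambda B (inv a) a"] inv[of "inv a" a] a aB
      by (simp add: a_inv_def)
    finally show "inv a \<in> A" .
  next
    fix a b assume "a \<in> A" "b \<in> A"
    then show "a \<otimes> b \<in> A"
      using A.m_closed[of a "brace_lambda B a b"] inv[of a b] AB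
      by (simp add: mult_eq_add_lambda subset_iff)
  qed (rule AB)
  with sub show ?thesis
    by (simp add: subbrace_def)
qed

lemma zero_brace_ideal: "brace_ideal {\<zero>} B"
  using add.triv_subgroup add.one_is_normal triv_subgroup one_is_normal
  by (auto simp: brace_ideal_def subbrace_def one_eq_zero)

section \<open>The centraliser of an ideal of fixed points\<close>

lemma brace_centraliser_iff:
  assumes "A \<subseteq> brace_Fix B"
  shows "x \<in> brace_centraliser B A \<longleftrightarrow>
    x \<in> carrier B \<and> (\<forall>i\<in>A. x \<oplus> i = i \<oplus> x \<and> brace_lambda B i x = x)"
proof -
  have "x \<oplus> i = i \<oplus> x \<and> x \<otimes> i = i \<otimes> x \<longleftrightarrow> x \<oplus> i = i \<oplus> x \<and> brace_lambda B i x = x"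
    if "x \<in> carrier B" "i \<in> A" for i
  proof -
    have i: "i \<in> carrier B" "brace_lambda B x i = i"
      using assms that by (auto simp: brace_Fix_def)
    show ?thesis
      using i that by (auto simp: mult_eq_add_lambda)
  qed
  then show ?thesis
    by (auto simp: brace_centraliser_def group_centraliser_def)
qed

context
  fixes I
  assumes ideal: "brace_ideal I B" and fixed: "I \<subseteq> brace_Fix B"
begin

lemma I_carrier: "i \<in> I \<Longrightarrow> i \<in> carrier B"
  and lambda_fix: "i \<in> I \<Longrightarrow> a \<in> carrier B \<Longrightarrow> brace_lambda B a i = i"
  using fixed by (auto simp: brace_Fix_def)

lemma mult_eq_add_fix: "i \<in> I \<Longrightarrow> a \<in> carrier B \<Longrightarrow> a \<otimes> i = a \<oplus> i"
  by (simp add: mult_eq_add_lambda I_carrier lambda_fix)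

lemma I_normal_add: "I \<lhd> add_monoid B"
  and I_normal_mult: "I \<lhd> B"
  using ideal by (auto simp: brace_ideal_def)

lemma add_swap:
  assumes "i \<in> I" "b \<in> carrier B"
  obtains j where "j \<in> I" "i \<oplus> b = b \<oplus> j"
proof
  show "\<ominus> b \<oplus> i \<oplus> b \<in> I"
    using normal.inv_op_closed1[OF I_normal_add, of b i] assms by (simp add: a_inv_def)
  show "i \<oplus> b = b \<oplus> (\<ominus> b \<oplus> i \<oplus> b)"
    using assms I_carrier by (simp add: add.m_assoc flip: add.m_assoc[of b "\<ominus> b"])
qed

lemma mult_swap:
  assumes "i \<in> I" "b \<in> carrier B"
  obtains j where "j \<in> I" "i \<otimes> b = b \<otimes> j"
proof
  show "inv b \<otimes> i \<otimes> b \<in> I"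
    using normal.inv_op_closed1[OF I_normal_mult, of b i] assms by simp
  show "i \<otimes> b = b \<otimes> (inv b \<otimes> i \<otimes> b)"
    using assms I_carrier by (simp add: m_assoc flip: m_assoc[of b "inv b"])
qed

text \<open>
  The element \<open>\<lambda>\<^sub>i b\<close> is \<open>- i + i b\<close>; moving \<open>i\<close> past \<open>b\<close> multiplicatively and \<open>- i\<close> past \<open>b\<close>
  additively leaves \<open>b\<close> followed by elements of \<open>I\<close>.
\<close>

lemma lambda_ideal_coset:
  assumes i: "i \<in> I" and b: "b \<in> carrier B"
  obtains k where "k \<in> I" "brace_lambda B i b = b \<oplus> k"
proof -
  obtain j where j: "j \<in> I" "i \<otimes> b = b \<otimes> j"
    using mult_swap i b .
  have "\<ominus> i \<in> I"
    using subgroup.m_inv_closed[OF normal_imp_subgroup[OF I_normal_add] i] by (simp add: a_inv_def)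
  then obtain l where l: "l \<in> I" "\<ominus> i \<oplus> b = b \<oplus> l"
    using add_swap b by blast
  show ?thesis
  proof
    show "l \<oplus> j \<in> I"
      using subgroup.m_closed[OF normal_imp_subgroup[OF I_normal_add] l(1) j(1)] by simp
    have "brace_lambda B i b = \<ominus> i \<oplus> (b \<oplus> j)"
      using b j by (simp add: brace_lambda_def mult_eq_add_fix)
    also have "\<dots> = b \<oplus> l \<oplus> j"
      using b i j I_carrier by (simp flip: add.m_assoc l(2))
    finally show "brace_lambda B i b = b \<oplus> (l \<oplus> j)"
      using b l j I_carrier by (simp add: add.m_assoc)
  qed
qed

lemma centraliser_lambda_closed:
  assumes c: "c \<in> brace_centraliser B I" and b: "b \<in> carrier B"
  shows "brace_lambda B b c \<in> brace_centraliser B I"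
proof -
  have cB: "c \<in> carrier B"
    using c by (simp add: brace_centraliser_iff[OF fixed])
  have "brace_lambda B b c \<oplus> i = i \<oplus> brace_lambda B b c" if i: "i \<in> I" for i
  proof -
    have "brace_lambda B b (c \<oplus> i) = brace_lambda B b (i \<oplus> c)"
      using c i by (simp add: brace_centraliser_iff[OF fixed])
    then show ?thesis
      using b cB i I_carrier by (simp add: lambda_add lambda_fix)
  qed
  moreover have "brace_lambda B i (brace_lambda B b c) = brace_lambda B b c" if i: "i \<in> I" for i
  proof -
    obtain j where j: "j \<in> I" "i \<otimes> b = b \<otimes> j"
      using mult_swap i b .
    have "brace_lambda B i (brace_lambda B b c) = brace_lambda B b (brace_lambda B j c)"
      using b cB i j I_carrier by (simp flip: lambda_mult)
    also have "brace_lambda B j c = c"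
      using c j by (simp add: brace_centraliser_iff[OF fixed])
    finally show ?thesis .
  qed
  ultimately show ?thesis
    using b cB by (simp add: brace_centraliser_iff[OF fixed])
qed

lemma centraliser_subbrace: "subbrace (brace_centraliser B I) B"
proof (rule subbrace_if_lambda_invariant)
  have add_cent: "subgroup (group_centraliser (add_monoid B) I) (add_monoid B)"
    by (rule add.subgroup_group_centraliser) (use I_carrier in auto)
  show "subgroup (brace_centraliser B I) (add_monoid B)"
  proof (rule add.subgroupI; (simp only: monoid.simps partial_object.simps flip: a_inv_def)?)
    show "brace_centraliser B I \<subseteq> carrier B"
      by (auto simp: brace_centraliser_iff[OF fixed])
    have "\<zero> \<in> brace_centraliser B I"
      using I_carrier by (simp add: brace_centraliser_iff[OF fixed])
    then show "brace_centraliser B I \<noteq> {}"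
      by blast
  next
    fix a assume a: "a \<in> brace_centraliser B I"
    then have "a \<in> group_centraliser (add_monoid B) I"
      by (simp add: brace_centraliser_def)
    from subgroup.m_inv_closed[OF add_cent this]
    show "\<ominus> a \<in> brace_centraliser B I"
      using a I_carrier
      by (simp add: brace_centraliser_iff[OF fixed] lambda_neg group_centraliser_def flip: a_inv_def)
  next
    fix a b assume ab: "a \<in> brace_centraliser B I" "b \<in> brace_centraliser B I"
    then have "a \<in> group_centraliser (add_monoid B) I" "b \<in> group_centraliser (add_monoid B) I"
      by (simp_all add: brace_centraliser_def)
    from subgroup.m_closed[OF add_cent this]
    show "a \<oplus> b \<in> brace_centraliser B I"
      using ab I_carrier
      by (simp add: brace_centraliser_iff[OF fixed] lambda_add group_centraliser_def)
  qed
qed (rule centraliser_lambda_closed)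

lemma centraliser_normal_add: "brace_centraliser B I \<lhd> add_monoid B"
proof (rule add.normal_invI; (simp only: monoid.simps partial_object.simps flip: a_inv_def)?)
  show "subgroup (brace_centraliser B I) (add_monoid B)"
    using centraliser_subbrace by (simp add: subbrace_def)
  fix b c assume b: "b \<in> carrier B" and c: "c \<in> brace_centraliser B I"
  have cB: "c \<in> carrier B"
    using c by (simp add: brace_centraliser_iff[OF fixed])
  define x where "x = b \<oplus> c \<oplus> \<ominus> b"
  have xB: "x \<in> carrier B" and xb: "x \<oplus> b = b \<oplus> c"
    using b cB by (simp_all add: x_def add.m_assoc)
  have "x \<in> group_centraliser (add_monoid B) I"
    using normal.inv_op_closed2[OF add.normal_group_centraliser[OF I_normal_add], of b c] b c
    by (simp add: x_def brace_centraliser_def flip: a_inv_def)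
  moreover have "brace_lambda B i x = x" if i: "i \<in> I" for i
  proof -
    obtain k where k: "k \<in> I" "brace_lambda B i b = b \<oplus> k"
      using lambda_ideal_coset i b .
    have kB: "k \<in> carrier B" and iB: "i \<in> carrier B"
      using k i I_carrier by auto
    \<comment> \<open>Apply \<open>\<lambda>\<^sub>i\<close> to \<open>x + b = b + c\<close>; the error term \<open>k\<close> then moves past \<open>c\<close> and cancels.\<close>
    have "brace_lambda B i x \<oplus> (b \<oplus> k) = brace_lambda B i (b \<oplus> c)"
      using b xB iB by (simp add: lambda_add flip: k(2) xb)
    also have "\<dots> = b \<oplus> (k \<oplus> c)"
      using b c cB i iB kB k(2) by (simp add: lambda_add brace_centraliser_iff[OF fixed] add.m_assoc)
    also have "k \<oplus> c = c \<oplus> k"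
      using c k by (simp add: brace_centraliser_iff[OF fixed])
    also have "b \<oplus> (c \<oplus> k) = x \<oplus> b \<oplus> k"
      using b cB kB xb by (simp add: add.m_assoc)
    also have "\<dots> = x \<oplus> (b \<oplus> k)"
      using b xB kB by (simp add: add.m_assoc)
    finally show ?thesis
      using b xB kB iB by simp
  qed
  ultimately show "b \<oplus> c \<oplus> \<ominus> b \<in> brace_centraliser B I"
    using xB by (simp add: brace_centraliser_iff[OF fixed] group_centraliser_def x_def)
qed

lemma centraliser_normal_mult: "brace_centraliser B I \<lhd> B"
proof (rule normal_invI)
  show "subgroup (brace_centraliser B I) B"
    using centraliser_subbrace by (simp add: subbrace_def)
  fix b c assume b: "b \<in> carrier B" and c: "c \<in> brace_centraliser B I"
  have cB: "c \<in> carrier B"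
    using c by (simp add: brace_centraliser_iff[OF fixed])
  define x where "x = b \<otimes> c \<otimes> inv b"
  have xB: "x \<in> carrier B" and xb: "x \<otimes> b = b \<otimes> c"
    using b cB by (simp_all add: x_def m_assoc)
  have "x \<in> group_centraliser B I"
    using normal.inv_op_closed2[OF normal_group_centraliser[OF I_normal_mult], of b c] b c
    by (simp add: x_def brace_centraliser_def)
  moreover have "x \<oplus> i = i \<oplus> x" if i: "i \<in> I" for i
  proof -
    obtain k where k: "k \<in> I" "i \<oplus> b = b \<oplus> k"
      using add_swap i b .
    have kB: "k \<in> carrier B" and iB: "i \<in> carrier B"
      using k i I_carrier by auto
    define y c' where "y = brace_lambda B x b" and "c' = brace_lambda B b c"
    have yB: "y \<in> carrier B" and c'B: "c' \<in> carrier B"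
      using b xB cB by (simp_all add: y_def c'_def)
    have xy: "x \<oplus> y = b \<oplus> c'"
      using xb b xB cB by (simp add: y_def c'_def mult_eq_add_lambda)
    \<comment> \<open>Conjugation by \<open>y\<close> on \<open>I\<close> agrees with conjugation by \<open>b\<close>.\<close>
    have yk: "i \<oplus> y = y \<oplus> k"
      using arg_cong[OF k(2), of "brace_lambda B x"] b xB iB kB i k(1)
      by (simp add: lambda_add lambda_fix y_def)
    have c'k: "k \<oplus> c' = c' \<oplus> k"
      using centraliser_lambda_closed[OF c b] k(1)
      by (simp add: brace_centraliser_iff[OF fixed] c'_def)
    have "(i \<oplus> x) \<oplus> y = (i \<oplus> b) \<oplus> c'"
      using iB xB yB b c'B xy by (simp add: add.m_assoc)
    also have "\<dots> = b \<oplus> (c' \<oplus> k)"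
      using b kB c'B c'k by (simp add: k(2) add.m_assoc)
    also have "\<dots> = (x \<oplus> y) \<oplus> k"
      using b kB c'B xy by (simp add: add.m_assoc)
    also have "\<dots> = (x \<oplus> i) \<oplus> y"
      using xB yB kB iB yk by (simp add: add.m_assoc)
    finally show ?thesis
      using xB yB iB by simp
  qed
  ultimately show "b \<otimes> c \<otimes> inv b \<in> brace_centraliser B I"
    using xB by (simp add: brace_centraliser_def group_centraliser_def x_def)
qed

lemma centraliser_brace_ideal: "brace_ideal (brace_centraliser B I) B"
  unfolding brace_ideal_def
  using centraliser_subbrace centraliser_lambda_closed centraliser_normal_add
    centraliser_normal_mult by blast

text \<open>
  The elements \<open>i j - (i + j)\<close> contribute nothing beyond the two commutator subgroups: if \<open>j\<close>
  centralises \<open>I\<close>, then \<open>i j = j i = j + i = i + j\<close>.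
\<close>

lemma ideal_commutator_trivial_iff:
  assumes J: "J \<subseteq> carrier B"
  shows "ideal_commutator B I J = {\<zero>} \<longleftrightarrow> J \<subseteq> brace_centraliser B I"
proof -
  have IB: "I \<subseteq> carrier B"
    using I_carrier by blast
  have add_iff: "commutator_subgroup (add_monoid B) I J \<subseteq> {\<zero>}
      \<longleftrightarrow> J \<subseteq> group_centraliser (add_monoid B) I"
    using add.commutator_subgroup_trivial_iff[of I J] IB J by simp
  have mult_iff: "commutator_subgroup B I J \<subseteq> {\<zero>} \<longleftrightarrow> J \<subseteq> group_centraliser B I"
    using commutator_subgroup_trivial_iff[of I J] IB J by (simp add: one_eq_zero)
  show ?thesis
  proof
    assume triv: "ideal_commutator B I J = {\<zero>}"
    have "commutator_subgroup (add_monoid B) I J \<subseteq> ideal_commutator B I J"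
      "commutator_subgroup B I J \<subseteq> ideal_commutator B I J"
      unfolding ideal_commutator_def by blast+
    then show "J \<subseteq> brace_centraliser B I"
      using add_iff mult_iff by (simp add: triv brace_centraliser_def)
  next
    assume C: "J \<subseteq> brace_centraliser B I"
    have "(i \<otimes> j) \<ominus> (i \<oplus> j) = \<zero>" if "i \<in> I" "j \<in> J" for i j
    proof -
      have "j \<in> carrier B" "brace_lambda B i j = j"
        using C that by (auto simp: brace_centraliser_iff[OF fixed])
      then show ?thesis
        using that I_carrier by (simp add: mult_eq_add_lambda a_minus_def)
    qed
    then have "{(i \<otimes> j) \<ominus> (i \<oplus> j) | i j. i \<in> I \<and> j \<in> J} \<subseteq> {\<zero>}"
      by blast
    then have "ideal_commutator B I J \<subseteq> {\<zero>}"
      using C add_iff mult_iff zero_brace_ideal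
      unfolding ideal_commutator_def brace_centraliser_def by blast
    moreover have "\<zero> \<in> K" if "brace_ideal K B" for K
      using that subgroup.one_closed[of K B] by (simp add: brace_ideal_def subbrace_def one_eq_zero)
    then have "\<zero> \<in> ideal_commutator B I J"
      unfolding ideal_commutator_def by blast
    ultimately show "ideal_commutator B I J = {\<zero>}"
      by blast
  qed
qed

lemma ideal_centraliser_eq: "ideal_centraliser B I = brace_centraliser B I"
proof -
  have sub: "K \<subseteq> carrier B" if "brace_ideal K B" for K
    using that subgroup.subset by (auto simp: brace_ideal_def subbrace_def)
  have triv: "ideal_commutator B I K = {\<zero>} \<longleftrightarrow> K \<subseteq> brace_centraliser B I"
    if "brace_ideal K B" for K
    using ideal_commutator_trivial_iff sub that by blast
  show ?thesis
    unfolding ideal_centraliser_def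
    by (rule the_equality) (use triv centraliser_brace_ideal in blast)+
qed

end

end

theorem corollary3p2:
  fixes B :: "('a, 'm) ring_scheme" and I :: "'a set"
  assumes "skew_brace B"
    and "finite (carrier B)"
    and "brace_ideal I B"
    and "I \<subseteq> brace_Fix B"
  shows "brace_ideal (brace_centraliser B I) B
    \<and> brace_centraliser B I = ideal_centraliser B I"
  using assms skew_brace.centraliser_brace_ideal skew_brace.ideal_centraliser_eq by metis

end
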